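(* Let $G$ be a difference graph with vertex-eigenvector $(x_1,\ldots,x_k;y_1,\ldots,y_k)$, $k\ge 1$, and let $T=(t_{pq})_{k\times k}$ be its characteristic matrix. Then $$\mathbf{a}_4(G)=\sum_{i=1}^{k-1}\Big(\sum_{p=1}^{k} t_{p,\,k-i+1}\Big)\Big(\sum_{p=i+1}^{k}\sum_{q=1}^{k-i} t_{pq}\Big).$$
   Context: All graphs are finite, simple and undirected. For a graph $G$ on $n$ vertices with adjacency matrix $\mathbf{A}(G)$, write $\det(\lambda I-\mathbf{A}(G))=\sum_{i=0}^n \mathbf{a}_i(G)\lambda^{n-i}$, so $\mathbf{a}_4(G)$ is the coefficient of $\lambda^{n-4}$. A difference graph with vertex bipartition $(X_1,\ldots,X_k;Y_1,\ldots,Y_k)$ is a graph whose vertex set is the disjoint union of nonempty sets $X_1,\ldots,X_k,Y_1,\ldots,Y_k$ and in which $x\in X_i$ and $y\in Y_j$ are adjacent if and only if $i+j\le k+1$, with no edges inside $X=\bigcup X_i$ or inside $Y=\bigcup Y_j$ (so each vertex of $X_i$ has neighborhood $Y_1\cup\cdots\cup Y_{k-i+1}$ and each vertex of $Y_i$ has neighborhood $X_1\cup\cdots\cup X_{k-i+1}$). Its vertex-eigenvector is $(x_1,\ldots,x_k;y_1,\ldots,y_k)$ with $x_i=|X_i|$, $y_i=|Y_i|$. The characteristic matrix $T=(t_{pq})_{k\times k}$ is defined by $t_{pq}=x_py_q$ if $p+q\le k+1$ and $t_{pq}=0$ otherwise. *)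

theory Defs
  imports "Graph_Theory.Pair_Digraph" "Jordan_Normal_Form.Char_Poly"
begin

text \<open>A finite simple undirected graph is a \<^locale>\<open>pair_graph\<close>: a finite vertex set with a symmetric,
  loop-free set of ordered pairs, each edge being present in both directions.\<close>

text \<open>The adjacency matrix depends on an ordering of the vertices, given by a list \<open>vs\<close>; it is
  used for distinct lists \<open>vs\<close> with \<open>set vs = pverts G\<close>.\<close>

definition adjacency_matrix :: "'a pair_pre_digraph \<Rightarrow> 'a list \<Rightarrow> real mat" where
  "adjacency_matrix G vs =
     mat (length vs) (length vs) (\<lambda>(i, j). if (vs ! i, vs ! j) \<in> parcs G then 1 else 0)"

text \<open>The coefficient of \<open>\<lambda>\<^sup>n\<^sup>-\<^sup>i\<close> in \<open>det (\<lambda>I - A)\<close> for an \<open>n \<times> n\<close> matrix \<open>A\<close>. It is only a coefficient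
  of the polynomial for \<open>i \<le> n\<close>; for \<open>i > n\<close> the exponent is negative and the value is 0. The case
  distinction is needed because \<open>n - i\<close> truncates on natural numbers.\<close>

definition char_poly_coeff :: "nat \<Rightarrow> real mat \<Rightarrow> real" where
  "char_poly_coeff i A =
     (if i \<le> dim_row A then coeff (char_poly A) (dim_row A - i) else 0)"

text \<open>Only the values of the families \<open>X\<close> and \<open>Y\<close> on the indices \<open>1, \<dots>, k\<close> are relevant.\<close>

definition difference_graph ::
  "nat \<Rightarrow> (nat \<Rightarrow> 'a set) \<Rightarrow> (nat \<Rightarrow> 'a set) \<Rightarrow> 'a pair_pre_digraph \<Rightarrow> bool" where
  "difference_graph k X Y G \<longleftrightarrow>
     pair_graph G \<and>
     (\<forall>i\<in>{1..k}. X i \<noteq> {} \<and> Y i \<noteq> {}) \<and>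
     disjoint_family_on X {1..k} \<and>
     disjoint_family_on Y {1..k} \<and>
     (\<Union>i\<in>{1..k}. X i) \<inter> (\<Union>j\<in>{1..k}. Y j) = {} \<and>
     pverts G = (\<Union>i\<in>{1..k}. X i) \<union> (\<Union>j\<in>{1..k}. Y j) \<and>
     (\<forall>i\<in>{1..k}. \<forall>j\<in>{1..k}. \<forall>u\<in>X i. \<forall>v\<in>Y j. (u, v) \<in> parcs G \<longleftrightarrow> i + j \<le> k + 1) \<and>
     (\<forall>u\<in>(\<Union>i\<in>{1..k}. X i). \<forall>v\<in>(\<Union>i\<in>{1..k}. X i). (u, v) \<notin> parcs G) \<and>
     (\<forall>u\<in>(\<Union>j\<in>{1..k}. Y j). \<forall>v\<in>(\<Union>j\<in>{1..k}. Y j). (u, v) \<notin> parcs G)"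

definition vertex_eigenvector ::
  "nat \<Rightarrow> (nat \<Rightarrow> 'a set) \<Rightarrow> (nat \<Rightarrow> 'a set) \<Rightarrow> (nat \<Rightarrow> nat) \<Rightarrow> (nat \<Rightarrow> nat) \<Rightarrow> bool" where
  "vertex_eigenvector k X Y x y \<longleftrightarrow> (\<forall>i\<in>{1..k}. x i = card (X i) \<and> y i = card (Y i))"

text \<open>The entries of the \<open>k \<times> k\<close> matrix \<open>T\<close>, with rows and columns numbered from 1.\<close>

definition characteristic_matrix ::
  "nat \<Rightarrow> (nat \<Rightarrow> nat) \<Rightarrow> (nat \<Rightarrow> nat) \<Rightarrow> nat \<Rightarrow> nat \<Rightarrow> real" where
  "characteristic_matrix k x y p q = (if p + q \<le> k + 1 then real (x p) * real (y q) else 0)"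

end

theory Submission
  imports Defs
begin

text \<open>The coefficient \<open>a\<^sub>4\<close> is the sum of the principal minors of order 4 of the adjacency matrix. In a
  bipartite graph such a minor vanishes unless the 4-set meets both sides in two vertices, and then
  it is the square of the determinant of a \<open>2 \<times> 2\<close> block of the biadjacency matrix. In a difference
  graph the neighbourhoods are nested, so the determinant is nonzero, and then \<open>\<plusminus>1\<close>, exactly when the
  4-set induces a path. Hence \<open>a\<^sub>4\<close> counts induced paths \<open>q - p - q' - p'\<close>. If \<open>q\<close> lies in class
  \<open>k - i + 1\<close>, then non-adjacency of \<open>p'\<close> and \<open>q\<close> says that \<open>p'\<close> has class at least \<open>i + 1\<close>, so the edges
  \<open>pq\<close> and \<open>p'q'\<close> can be chosen independently, which gives the two factors of the summand \<open>i\<close>.\<close>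

section \<open>Principal minors and the coefficients of the characteristic polynomial\<close>

text \<open>The Leibniz formula runs over permutations of the index set itself, so no submatrix has
  to be renumbered.\<close>

definition principal_minor :: "('i \<Rightarrow> 'i \<Rightarrow> 'b::comm_ring_1) \<Rightarrow> 'i set \<Rightarrow> 'b" where
  "principal_minor a S = (\<Sum>p | p permutes S. of_int (sign p) * (\<Prod>i\<in>S. a i (p i)))"

lemma prod_const_poly: "(\<Prod>i\<in>S. [:f i:]) = [:\<Prod>i\<in>S. f i:]"
  for f :: "'i \<Rightarrow> 'b::comm_ring_1"
  by (induction S rule: infinite_finite_induct) (auto simp: one_pCons)

text \<open>Expanding each Leibniz product of XI - A selects the set \<open>S\<close> of positions
  that contribute an entry of -A. The other positions contribute X and must be fixed by
  \<open>p\<close>, so \<open>p\<close> permutes \<open>S\<close>; swapping the two sums leaves one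
  minor per \<open>S\<close>.\<close>

lemma char_poly_principal_minors:
  fixes A :: "'b::comm_ring_1 mat"
  assumes A: "A \<in> carrier_mat n n"
  shows "char_poly A = (\<Sum>S\<in>Pow {0..<n}.
    monom ((-1) ^ card S * principal_minor (\<lambda>i j. A $$ (i, j)) S) (n - card S))"
proof -
  let ?U = "{0..<n}"
  let ?X = "[:0, 1:] :: 'b poly"
  let ?f = "\<lambda>p S. (-1) ^ card S * signof p * (\<Prod>i\<in>S. A $$ (i, p i))"
  have fix_outside: "(\<Prod>i\<in>?U - S. if i = p i then ?X else 0) =
      (if p permutes S then monom 1 (n - card S) else 0)"
    if p: "p permutes ?U" and S: "S \<subseteq> ?U" for p S
  proof (cases "\<forall>i\<in>?U - S. p i = i")
    case True
    then have "p permutes S" using p by (intro permutes_superset[of p ?U S]) auto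
    moreover have "(\<Prod>i\<in>?U - S. if i = p i then ?X else 0) = (\<Prod>i\<in>?U - S. ?X)"
      using True by (intro prod.cong) auto
    ultimately show ?thesis using S
      by (simp add: card_Diff_subset finite_subset[OF S] monom_altdef)
  next
    case False
    then have "\<not> p permutes S" by (auto simp: permutes_def)
    moreover have "(\<Prod>i\<in>?U - S. if i = p i then ?X else 0) = 0"
      using False by (intro prod_zero) (auto intro!: bexI)
    ultimately show ?thesis by simp
  qed
  have "char_poly A = (\<Sum>p | p permutes ?U. signof p *
      (\<Prod>i\<in>?U. (if i = p i then ?X else 0) - [:A $$ (i, p i):]))"
    unfolding char_poly_def det_def'[OF char_poly_matrix_closed[OF A]]
  proof (intro sum.cong refl arg_cong2[where f="(*)"] prod.cong)
    fix p i assume "p \<in> {p. p permutes ?U}" "i \<in> ?U"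
    then have "i < n" "p i < n" using permutes_in_image[of p ?U i] by auto
    then show "char_poly_matrix A $$ (i, p i) = (if i = p i then ?X else 0) - [:A $$ (i, p i):]"
      using A by (auto simp: char_poly_matrix_def)
  qed
  also have "\<dots> = (\<Sum>p | p permutes ?U. \<Sum>S\<in>Pow ?U.
      if p permutes S then monom (?f p S) (n - card S) else 0)"
  proof (intro sum.cong refl)
    fix p assume p: "p \<in> {p. p permutes ?U}"
    have "signof p * (\<Prod>i\<in>?U. (if i = p i then ?X else 0) - [:A $$ (i, p i):]) =
        (\<Sum>S\<in>Pow ?U. signof p * ((-1) ^ card S * [:\<Prod>i\<in>S. A $$ (i, p i):] *
          (if p permutes S then monom 1 (n - card S) else 0)))"
      using p by (simp add: prod_diff_conv_sum prod_const_poly fix_outside sum_distrib_left)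
    also have "\<dots> = (\<Sum>S\<in>Pow ?U. if p permutes S then monom (?f p S) (n - card S) else 0)"
    proof (intro sum.cong refl)
      fix S :: "nat set"
      \<comment> \<open>As constant polynomials, the signs merge with the entries into the
        coefficient of a single monomial.\<close>
      have "signof p = [:signof p :: 'b:]" by (simp add: sign_def one_pCons)
      moreover have "(-1) ^ card S = [:(-1) ^ card S :: 'b:]"
        unfolding minus_one_power_iff by (simp add: one_pCons)
      ultimately show "signof p * ((-1) ^ card S * [:\<Prod>i\<in>S. A $$ (i, p i):] *
          (if p permutes S then monom 1 (n - card S) else 0)) =
        (if p permutes S then monom (?f p S) (n - card S) else 0)"
        by (simp only:) (simp add: smult_monom mult.left_commute mult.commute)
    qed
    finally show "signof p * (\<Prod>i\<in>?U. (if i = p i then ?X else 0) - [:A $$ (i, p i):]) =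
      (\<Sum>S\<in>Pow ?U. if p permutes S then monom (?f p S) (n - card S) else 0)" .
  qed
  also have "\<dots> = (\<Sum>S\<in>Pow ?U. \<Sum>p | p permutes ?U.
      if p permutes S then monom (?f p S) (n - card S) else 0)"
    by (rule sum.swap)
  also have "\<dots> = (\<Sum>S\<in>Pow ?U. \<Sum>p | p permutes S. monom (?f p S) (n - card S))"
  proof (rule sum.cong[OF refl])
    fix S assume S: "S \<in> Pow ?U"
    have "{p. p permutes ?U} \<inter> {p. p permutes S} = {p. p permutes S}"
      using S by (auto intro: permutes_subset)
    then show "(\<Sum>p | p permutes ?U. if p permutes S then monom (?f p S) (n - card S) else 0) =
        (\<Sum>p | p permutes S. monom (?f p S) (n - card S))"
      by (simp add: sum.If_cases finite_permutations)
  qed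
  finally show ?thesis
    by (simp add: principal_minor_def sum_distrib_left monom_sum mult.assoc)
qed

lemma coeff_char_poly:
  fixes A :: "'b::comm_ring_1 mat"
  assumes A: "A \<in> carrier_mat n n" and m: "m \<le> n"
  shows "coeff (char_poly A) (n - m) =
    (-1) ^ m * (\<Sum>S | S \<subseteq> {0..<n} \<and> card S = m. principal_minor (\<lambda>i j. A $$ (i, j)) S)"
proof -
  let ?M = "principal_minor (\<lambda>i j. A $$ (i, j))"
  \<comment> \<open>Truncated subtraction loses nothing here, as \<open>card S\<close> and
    \<open>m\<close> are both at most \<open>n\<close>.\<close>
  have deg: "n - card S = n - m \<longleftrightarrow> card S = m" if "S \<in> Pow {0..<n}" for S
    using card_mono[of "{0..<n}" S] that m by auto
  have "coeff (char_poly A) (n - m) =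
      (\<Sum>S\<in>Pow {0..<n}. if card S = m then (-1) ^ card S * ?M S else 0)"
    unfolding char_poly_principal_minors[OF A] coeff_sum
    by (intro sum.cong refl) (simp add: deg)
  also have "\<dots> = (\<Sum>S\<in>Pow {0..<n} \<inter> {S. card S = m}. (-1) ^ card S * ?M S)"
    by (simp add: sum.If_cases)
  also have "\<dots> = (\<Sum>S | S \<subseteq> {0..<n} \<and> card S = m. (-1) ^ m * ?M S)"
    by (intro sum.cong) auto
  finally show ?thesis by (simp add: sum_distrib_left)
qed

text \<open>The six edges of a 4-set form three perfect matchings, with weights \<open>m1\<close>, \<open>m2\<close>, \<open>m3\<close>: the double
  transpositions contribute the squares, the 4-cycles the mixed products.\<close>

lemma principal_minor_4:
  fixes a :: "'i \<Rightarrow> 'i \<Rightarrow> 'b::comm_ring_1"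
  assumes sym: "\<And>i j. a i j = a j i" and diag: "\<And>i. a i i = 0"
    and dist: "distinct [i, j, k, l]"
  defines "m1 \<equiv> a i j * a k l" and "m2 \<equiv> a i k * a j l" and "m3 \<equiv> a i l * a j k"
  shows "principal_minor a {i, j, k, l} =
    m1\<^sup>2 + m2\<^sup>2 + m3\<^sup>2 - 2 * (m1 * m2 + m1 * m3 + m2 * m3)"
proof -
  have ne: "i \<noteq> j" "i \<noteq> k" "i \<noteq> l" "j \<noteq> k" "j \<noteq> l" "k \<noteq> l"
      "j \<noteq> i" "k \<noteq> i" "l \<noteq> i" "k \<noteq> j" "l \<noteq> j" "l \<noteq> k"
    using dist by auto
  have f: "i \<notin> {j, k, l}" "j \<notin> {k, l}" "k \<notin> {l}" using ne by auto
  have s: "a j i = a i j" "a k i = a i k" "a l i = a i l" "a k j = a j k" "a l j = a j l" "a l k = a k l"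
    using sym by auto
  show ?thesis
    unfolding principal_minor_def m1_def m2_def m3_def
    unfolding sum_over_permutations_insert[OF _ f(1), simplified]
    unfolding sum_over_permutations_insert[OF _ f(2), simplified]
    unfolding sum_over_permutations_insert[OF _ f(3), simplified]
    unfolding permutes_sing
    using ne
    by (simp add: sign_swap_id permutation_swap_id sign_compose permutation_compose transpose_def diag s)
      (simp add: algebra_simps power2_eq_square)
qed

text \<open>Matrix entries are specified only in range, whereas \<open>principal_minor_4\<close>
  asks for symmetry and a zero diagonal at all indices; this lemma bridges the gap.\<close>

lemma principal_minor_cong:
  assumes "\<And>i j. i \<in> S \<Longrightarrow> j \<in> S \<Longrightarrow> a i j = b i j"
  shows "principal_minor a S = principal_minor b S"
  unfolding principal_minor_def
  using assms by (intro sum.cong refl arg_cong2[where f="(*)"] prod.cong) (auto simp: permutes_in_image)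

section \<open>Counting induced paths in a nested bipartite graph\<close>

text \<open>\<open>nested\<close> rules out two disjoint edges with no edge across, whose minor
  would also be 1, and a 4-cycle has minor 0. A remaining path has exactly one end in
  \<open>Q\<close>; reading it from there counts it once.\<close>

lemma sum_principal_minors_4_nested_bipartite:
  fixes E :: "'i \<Rightarrow> 'i \<Rightarrow> bool" and P Q :: "'i set"
  assumes fin: "finite P" "finite Q" and disj: "P \<inter> Q = {}"
    and sym: "\<And>i j. E i j \<longleftrightarrow> E j i"
    and loopfree: "\<And>i. \<not> E i i"
    and indep: "\<And>i j. i \<in> P \<Longrightarrow> j \<in> P \<Longrightarrow> \<not> E i j" "\<And>i j. i \<in> Q \<Longrightarrow> j \<in> Q \<Longrightarrow> \<not> E i j"
    and nested: "\<And>p p' q q'. p \<in> P \<Longrightarrow> p' \<in> P \<Longrightarrow> q \<in> Q \<Longrightarrow> q' \<in> Q \<Longrightarrow>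
      E p q \<Longrightarrow> E p' q' \<Longrightarrow> E p q' \<or> E p' q"
  shows "(\<Sum>S | S \<subseteq> P \<union> Q \<and> card S = 4. principal_minor (\<lambda>i j. of_bool (E i j)) S) =
    (\<Sum>q\<in>Q. \<Sum>p\<in>P. \<Sum>p'\<in>P. \<Sum>q'\<in>Q. of_bool (E p q \<and> E p' q' \<and> E p q' \<and> \<not> E p' q) :: real)"
proof -
  let ?M = "principal_minor (\<lambda>i j. of_bool (E i j) :: real)"
  define F where "F = {(q, p, p', q'). q \<in> Q \<and> p \<in> P \<and> p' \<in> P \<and> q' \<in> Q \<and>
    E p q \<and> E p' q' \<and> E p q' \<and> \<not> E p' q}"
  \<comment> \<open>\<open>F\<close> collects the induced paths \<open>q - p - q' - p'\<close>; each is determined by its vertex set.\<close>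
  define vert where "vert = (\<lambda>(q, p, p', q'). {q, p, p', q'} :: 'i set)"
  \<comment> \<open>In \<open>principal_minor_4\<close> this is \<open>m1 = 1\<close> and
    \<open>m2 = 0\<close>, so the minor is \<open>(1 - m3)^2\<close> with \<open>m3\<close> the
    product of the two cross entries.\<close>
  have minor: "?M {p, q, p', q'} = (if E p q' \<and> E p' q then 0 else 1)"
    if "p \<in> P" "q \<in> Q" "p' \<in> P" "q' \<in> Q" "E p q" "E p' q'" "p \<noteq> p'" "q \<noteq> q'" for p q p' q'
  proof -
    have "distinct [p, q, p', q']" using that disj by auto
    then show ?thesis
      using that indep by (subst principal_minor_4) (auto simp: sym loopfree)
  qed
  have FI: "\<exists>t\<in>F. vert t = {p, q, p', q'}"
    if pq: "p \<in> P" "q \<in> Q" "p' \<in> P" "q' \<in> Q" "E p q" "E p' q'" "p \<noteq> p'" "q \<noteq> q'"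
      and nz: "?M {p, q, p', q'} \<noteq> 0" for p q p' q'
  proof -
    have "\<not> (E p q' \<and> E p' q)" using minor[OF pq] nz by auto
    moreover have "E p q' \<or> E p' q" by (rule nested) fact+
    \<comment> \<open>If \<open>p q'\<close> is the missing edge, the path is read with the two
      given edges exchanged.\<close>
    ultimately have "(q, p, p', q') \<in> F \<or> (q', p', p, q) \<in> F"
      using pq by (auto simp: F_def)
    moreover have "vert (q, p, p', q') = {p, q, p', q'}" "vert (q', p', p, q) = {p, q, p', q'}"
      by (auto simp: vert_def)
    ultimately show ?thesis by blast
  qed
  have FI': "\<exists>t\<in>F. vert t = {a, b, c, d}"
    if "{a, b, c, d} \<subseteq> P \<union> Q" "distinct [a, b, c, d]" "E a b" "E c d" "?M {a, b, c, d} \<noteq> 0"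
    for a b c d
  proof -
    \<comment> \<open>Both sides are independent, so each edge crosses; its four possible
      orientations reduce to \<open>FI\<close>.\<close>
    have "a \<in> P \<and> b \<in> Q \<or> b \<in> P \<and> a \<in> Q" "c \<in> P \<and> d \<in> Q \<or> d \<in> P \<and> c \<in> Q"
      using that indep by blast+
    moreover have "{b, a, c, d} = {a, b, c, d}" "{a, b, d, c} = {a, b, c, d}" "{b, a, d, c} = {a, b, c, d}"
      by auto
    ultimately show ?thesis
      using that FI[of a b c d] FI[of b a c d] FI[of a b d c] FI[of b a d c] sym by auto
  qed
  have zero: "?M S = 0" if S: "S \<subseteq> P \<union> Q" "card S = 4" "S \<notin> vert ` F" for S
  proof (rule ccontr)
    assume nz: "?M S \<noteq> 0"
    obtain a b c d where S_eq: "S = {a, b, c, d}" and dist: "distinct [a, b, c, d]"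
      using S(2) by (auto simp: card_Suc_eq numeral_eq_Suc)
    \<comment> \<open>Without a perfect matching all three weights vanish, and with them the
      minor.\<close>
    have "E a b \<and> E c d \<or> E a c \<and> E b d \<or> E a d \<and> E b c"
      using nz dist unfolding S_eq
      by (subst (asm) principal_minor_4) (auto simp: sym loopfree)
    moreover have "{a, c, b, d} = {a, b, c, d}" "{a, d, b, c} = {a, b, c, d}" by auto
    ultimately have "\<exists>t\<in>F. vert t = S"
      using FI'[of a b c d] FI'[of a c b d] FI'[of a d b c] S(1) nz dist S_eq by auto
    then show False using S(3) by blast
  qed
  have one: "?M (vert t) = 1" and vert_sub: "vert t \<subseteq> P \<union> Q \<and> card (vert t) = 4" if t: "t \<in> F" for t
  proof -
    obtain q p p' q' where t_eq: "t = (q, p, p', q')" by (cases t)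
    have F: "p \<in> P" "q \<in> Q" "p' \<in> P" "q' \<in> Q" "E p q" "E p' q'" "E p q'" "\<not> E p' q"
      using t by (auto simp: F_def t_eq)
    then have "p \<noteq> p'" "q \<noteq> q'" by auto
    moreover have "vert t = {p, q, p', q'}" by (auto simp: vert_def t_eq)
    moreover have "p \<noteq> q" "p \<noteq> q'" "p' \<noteq> q" "p' \<noteq> q'" using F disj by auto
    ultimately show "?M (vert t) = 1" "vert t \<subseteq> P \<union> Q \<and> card (vert t) = 4"
      using minor[of p q p' q'] F by auto
  qed
  have inj: "inj_on vert F"
  proof (rule inj_onI)
    fix s t assume s: "s \<in> F" and t: "t \<in> F" and eq: "vert s = vert t"
    obtain q p p' q' where s_eq: "s = (q, p, p', q')" by (cases s)
    obtain v u u' v' where t_eq: "t = (v, u, u', v')" by (cases t)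
    \<comment> \<open>Intersecting with \<open>P\<close> and \<open>Q\<close> recovers both pairs;
      the single non-edge \<open>p' q\<close> between them tells which vertex is which.\<close>
    have "vert s \<inter> P = {p, p'}" "vert t \<inter> P = {u, u'}" "vert s \<inter> Q = {q, q'}" "vert t \<inter> Q = {v, v'}"
      using s t disj by (auto simp: F_def vert_def s_eq t_eq)
    then have "{p, p'} = {u, u'}" "{q, q'} = {v, v'}" using eq by auto
    then show "s = t" using s t unfolding doubleton_eq_iff F_def s_eq t_eq by auto
  qed
  have "(\<Sum>S | S \<subseteq> P \<union> Q \<and> card S = 4. ?M S) = (\<Sum>S\<in>vert ` F. ?M S)"
  proof (rule sum.mono_neutral_right)
    show "vert ` F \<subseteq> {S. S \<subseteq> P \<union> Q \<and> card S = 4}" using vert_sub by blast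
  qed (use fin zero in auto)
  also have "\<dots> = (\<Sum>t\<in>F. ?M (vert t))"
    using sum.reindex[OF inj, of ?M] by simp
  also have "\<dots> = (\<Sum>t\<in>F. 1)" using one by simp
  also have "\<dots> = (\<Sum>t\<in>Q \<times> P \<times> P \<times> Q. of_bool (t \<in> F))"
    using fin by (intro sum.mono_neutral_cong_left) (auto simp: F_def)
  also have "\<dots> = (\<Sum>q\<in>Q. \<Sum>p\<in>P. \<Sum>p'\<in>P. \<Sum>q'\<in>Q. of_bool ((q, p, p', q') \<in> F))"
    by (simp add: sum.cartesian_product case_prod_unfold)
  also have "\<dots> = (\<Sum>q\<in>Q. \<Sum>p\<in>P. \<Sum>p'\<in>P. \<Sum>q'\<in>Q. of_bool (E p q \<and> E p' q' \<and> E p q' \<and> \<not> E p' q))"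
    by (intro sum.cong refl) (auto simp: F_def)
  finally show ?thesis .
qed

section \<open>From sums over vertices to sums over classes\<close>

lemma sum_over_classes:
  fixes c :: "'a \<Rightarrow> nat" and f :: "nat \<Rightarrow> real"
  assumes "distinct vs" "(\<Union>a\<in>I. X a) \<subseteq> set vs" "finite I" "\<And>a u. a \<in> I \<Longrightarrow> u \<in> X a \<Longrightarrow> c u = a"
  shows "(\<Sum>j | j < length vs \<and> vs ! j \<in> (\<Union>a\<in>I. X a). f (c (vs ! j))) = (\<Sum>a\<in>I. real (card (X a)) * f a)"
proof -
  let ?U = "\<Union>a\<in>I. X a"
  have "bij_betw ((!) vs) {j. j < length vs \<and> vs ! j \<in> ?U} ?U"
    unfolding bij_betw_def
  proof
    show "inj_on ((!) vs) {j. j < length vs \<and> vs ! j \<in> ?U}"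
      using assms(1) by (auto simp: inj_on_def nth_eq_iff_index_eq)
    show "(!) vs ` {j. j < length vs \<and> vs ! j \<in> ?U} = ?U"
    proof (intro equalityI subsetI)
      fix u assume u: "u \<in> ?U"
      then obtain j where "j < length vs" "vs ! j = u"
        using assms(2) by (metis in_set_conv_nth subsetD)
      then show "u \<in> (!) vs ` {j. j < length vs \<and> vs ! j \<in> ?U}" using u by auto
    qed auto
  qed
  then have "(\<Sum>j | j < length vs \<and> vs ! j \<in> ?U. f (c (vs ! j))) = (\<Sum>u\<in>?U. f (c u))"
    by (rule sum.reindex_bij_betw)
  also have "\<dots> = (\<Sum>a\<in>I. \<Sum>u\<in>X a. f (c u))"
  proof (rule sum.UNION_disjoint[OF assms(3)])
    show "\<forall>a\<in>I. finite (X a)"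
      using assms(2) by (meson UN_subset_iff finite_set finite_subset)
    \<comment> \<open>Disjointness comes from \<open>c\<close>, which takes a different value on
      each class.\<close>
    show "\<forall>a\<in>I. \<forall>b\<in>I. a \<noteq> b \<longrightarrow> X a \<inter> X b = {}" by (metis assms(4) disjoint_iff)
  qed
  also have "\<dots> = (\<Sum>a\<in>I. \<Sum>u\<in>X a. f a)" using assms(4) by simp
  finally show ?thesis by simp
qed

text \<open>The right side is the path count by classes: \<open>d\<close>, \<open>a\<close>,
  \<open>b\<close>, \<open>c\<close> are the classes of \<open>q\<close>, \<open>p\<close>,
  \<open>p'\<close>, \<open>q'\<close>, and \<open>d = k - i + 1\<close>.\<close>

lemma sum_characteristic_matrix:
  fixes x y :: "nat \<Rightarrow> nat" and k :: nat
  defines "T \<equiv> characteristic_matrix k x y"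
  shows "(\<Sum>i = 1..k - 1. (\<Sum>p = 1..k. T p (k - i + 1)) * (\<Sum>p = i + 1..k. \<Sum>q = 1..k - i. T p q)) =
   (\<Sum>d = 1..k. real (y d) * (\<Sum>a = 1..k. real (x a) * (\<Sum>b = 1..k. real (x b) * (\<Sum>c = 1..k. real (y c) *
     of_bool (a + d \<le> k + 1 \<and> b + c \<le> k + 1 \<and> a + c \<le> k + 1 \<and> \<not> b + d \<le> k + 1)))))"
    (is "_ = (\<Sum>d = 1..k. ?g d)")
proof -
  have "(\<Sum>p = 1..k. T p d) * (\<Sum>p = k - d + 2..k. \<Sum>q = 1..d - 1. T p q) = ?g d"
    if d: "d \<in> {1..k}" for d
  proof -
    \<comment> \<open>\<open>b \<ge> k - d + 2\<close> says \<open>b + d > k + 1\<close>; together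
      with \<open>b + c \<le> k + 1\<close> it forces \<open>c \<le> d - 1\<close>, so extending
      both ranges adds only zeros.\<close>
    have inner: "(\<Sum>b = k - d + 2..k. \<Sum>c = 1..d - 1. T b c) =
        (\<Sum>b = 1..k. \<Sum>c = 1..k. of_bool (\<not> b + d \<le> k + 1) * T b c)"
    proof (rule sum.mono_neutral_cong_left)
      fix b assume b: "b \<in> {k - d + 2..k}"
      show "(\<Sum>c = 1..d - 1. T b c) = (\<Sum>c = 1..k. of_bool (\<not> b + d \<le> k + 1) * T b c)"
        using b d by (intro sum.mono_neutral_cong_left) (auto simp: T_def characteristic_matrix_def)
    qed (use d in auto)
    \<comment> \<open>The condition \<open>a + c \<le> k + 1\<close> follows from
      \<open>c < d\<close> and \<open>a + d \<le> k + 1\<close>, so the indicator splits into the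
      two factors.\<close>
    show ?thesis
      unfolding inner sum_distrib_right unfolding sum_distrib_left
      by (intro sum.cong refl) (auto simp: T_def characteristic_matrix_def)
  qed
  note g = this
  have "(\<Sum>i = 1..k - 1. (\<Sum>p = 1..k. T p (k - i + 1)) * (\<Sum>p = i + 1..k. \<Sum>q = 1..k - i. T p q)) =
    (\<Sum>i = 1..k - 1. ?g (k - i + 1))"
  proof (intro sum.cong refl)
    fix i assume i: "i \<in> {1..k - 1}"
    then have "k - i + 1 \<in> {1..k}" "k - (k - i + 1) + 2 = i + 1" "k - i + 1 - 1 = k - i" by auto
    then show "(\<Sum>p = 1..k. T p (k - i + 1)) * (\<Sum>p = i + 1..k. \<Sum>q = 1..k - i. T p q) = ?g (k - i + 1)"
      using g[of "k - i + 1"] by simp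
  qed
  also have "\<dots> = (\<Sum>d = 2..k. ?g d)"
    by (rule sum.reindex_bij_witness[of _ "\<lambda>d. k - d + 1" "\<lambda>i. k - i + 1"]) auto
  also have "\<dots> = (\<Sum>d = 1..k. ?g d)"
  proof (rule sum.mono_neutral_left)
    \<comment> \<open>For \<open>d = 1\<close> the condition \<open>\<not> b + d \<le> k + 1\<close>
      fails for every \<open>b \<le> k\<close>.\<close>
    show "\<forall>d\<in>{1..k} - {2..k}. ?g d = 0"
    proof
      fix d assume "d \<in> {1..k} - {2..k}"
      then have "d = 1" by auto
      then show "?g d = 0" by simp
    qed
  qed auto
  finally show ?thesis .
qed

lemma the_class_index:
  assumes "disjoint_family_on X I" "a \<in> I" "u \<in> X a"
  shows "(THE b. b \<in> I \<and> u \<in> X b) = a"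
proof (rule the_equality)
  show "b = a" if "b \<in> I \<and> u \<in> X b" for b
    using disjoint_family_onD[OF assms(1), of b a] assms(2,3) that by auto
qed (use assms in simp)

section \<open>The fourth coefficient of a difference graph\<close>

theorem theorem4p5:
  fixes G :: "'a pair_pre_digraph" and X Y :: "nat \<Rightarrow> 'a set"
    and x y :: "nat \<Rightarrow> nat" and k :: nat and T :: "nat \<Rightarrow> nat \<Rightarrow> real" and vs :: "'a list"
  assumes "k \<ge> 1"
    and "difference_graph k X Y G"
    and "vertex_eigenvector k X Y x y"
    and "T = characteristic_matrix k x y"
    and "distinct vs" and "set vs = pverts G"
  shows "char_poly_coeff 4 (adjacency_matrix G vs) =
    (\<Sum>i = 1..k - 1. (\<Sum>p = 1..k. T p (k - i + 1)) *
                     (\<Sum>p = i + 1..k. \<Sum>q = 1..k - i. T p q))"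
proof -
  let ?UX = "\<Union>i\<in>{1..k}. X i" and ?UY = "\<Union>j\<in>{1..k}. Y j"
  let ?n = "length vs"
  \<comment> \<open>The matrix is indexed by positions in \<open>vs\<close>, so the two sides become
    sets of positions.\<close>
  define P where "P = {j. j < ?n \<and> vs ! j \<in> ?UX}"
  define Q where "Q = {j. j < ?n \<and> vs ! j \<in> ?UY}"
  define E where "E = (\<lambda>i j. (vs ! i, vs ! j) \<in> parcs G)"
  have "pair_graph G" and dg: "disjoint_family_on X {1..k}" "disjoint_family_on Y {1..k}"
      "?UX \<inter> ?UY = {}" "pverts G = ?UX \<union> ?UY"
    and adj: "\<forall>i\<in>{1..k}. \<forall>j\<in>{1..k}. \<forall>u\<in>X i. \<forall>v\<in>Y j. (u, v) \<in> parcs G \<longleftrightarrow> i + j \<le> k + 1"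
    and indepX: "\<forall>u\<in>?UX. \<forall>v\<in>?UX. (u, v) \<notin> parcs G"
    and indepY: "\<forall>u\<in>?UY. \<forall>v\<in>?UY. (u, v) \<notin> parcs G"
    using assms(2) unfolding difference_graph_def by - (elim conjE, assumption)+
  interpret pair_graph G by fact
  have E_sym: "E i j \<longleftrightarrow> E j i" for i j
    using arcs_symmetric by (auto simp: E_def)
  have E_loopfree: "\<not> E i i" for i
    by (auto simp: E_def dest: no_loops)
  define cx where "cx = (\<lambda>u. THE a. a \<in> {1..k} \<and> u \<in> X a)"
  define cy where "cy = (\<lambda>u. THE a. a \<in> {1..k} \<and> u \<in> Y a)"
  have cx: "cx u = a" if "a \<in> {1..k}" "u \<in> X a" for a u
    unfolding cx_def using that by (rule the_class_index[OF dg(1)])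
  have cy: "cy u = a" if "a \<in> {1..k}" "u \<in> Y a" for a u
    unfolding cy_def using that by (rule the_class_index[OF dg(2)])
  have E_iff: "E p q \<longleftrightarrow> cx (vs ! p) + cy (vs ! q) \<le> k + 1" if "p \<in> P" "q \<in> Q" for p q
  proof -
    obtain a b where "a \<in> {1..k}" "vs ! p \<in> X a" "b \<in> {1..k}" "vs ! q \<in> Y b"
      using \<open>p \<in> P\<close> \<open>q \<in> Q\<close> unfolding P_def Q_def by blast
    then show ?thesis using adj cx cy by (simp add: E_def)
  qed
  have PQ: "{0..<?n} = P \<union> Q"
    using dg(4) assms(6) nth_mem[of _ vs] by (auto simp: P_def Q_def)
  \<comment> \<open>\<open>h\<close> may itself be a nested sum, so the four sums can be converted
    one by one from the outside.\<close>
  have sumX: "(\<Sum>p\<in>P. h p) = (\<Sum>a = 1..k. real (x a) * f a)"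
    if "\<And>p. p \<in> P \<Longrightarrow> h p = f (cx (vs ! p))" for h f
  proof -
    have "(\<Sum>p\<in>P. h p) = (\<Sum>p\<in>P. f (cx (vs ! p)))" using that by simp
    also have "\<dots> = (\<Sum>a = 1..k. real (card (X a)) * f a)"
      unfolding P_def using assms(5,6) dg(4) cx by (intro sum_over_classes) auto
    finally show ?thesis using assms(3) by (simp add: vertex_eigenvector_def)
  qed
  have sumY: "(\<Sum>q\<in>Q. h q) = (\<Sum>b = 1..k. real (y b) * f b)"
    if "\<And>q. q \<in> Q \<Longrightarrow> h q = f (cy (vs ! q))" for h f
  proof -
    have "(\<Sum>q\<in>Q. h q) = (\<Sum>q\<in>Q. f (cy (vs ! q)))" using that by simp
    also have "\<dots> = (\<Sum>b = 1..k. real (card (Y b)) * f b)"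
      unfolding Q_def using assms(5,6) dg(4) cy by (intro sum_over_classes) auto
    finally show ?thesis using assms(3) by (simp add: vertex_eigenvector_def)
  qed
  let ?A = "adjacency_matrix G vs"
  have A: "?A \<in> carrier_mat ?n ?n" by (simp add: adjacency_matrix_def)
  then have dim: "dim_row ?A = ?n" by auto
  have entry: "?A $$ (i, j) = of_bool (E i j)" if "i < ?n" "j < ?n" for i j
    using that by (simp add: adjacency_matrix_def E_def)
  have "char_poly_coeff 4 ?A =
      (\<Sum>S | S \<subseteq> {0..<?n} \<and> card S = 4. principal_minor (\<lambda>i j. ?A $$ (i, j)) S)"
  \<comment> \<open>The sign is \<open>(-1) ^ 4 = 1\<close>. Below 4 vertices both sides are 0: the
    left by the convention in \<open>char_poly_coeff\<close>, the right because there is no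
    4-subset.\<close>
  proof (cases "4 \<le> ?n")
    case True
    then show ?thesis by (simp add: char_poly_coeff_def dim coeff_char_poly[OF A True])
  next
    case False
    have "card S \<noteq> 4" if "S \<subseteq> {0..<?n}" for S
      using card_mono[OF _ that] False by simp
    then have none: "{S. S \<subseteq> {0..<?n} \<and> card S = 4} = {}" by auto
    show ?thesis unfolding none using False by (simp add: char_poly_coeff_def dim)
  qed
  also have "\<dots> = (\<Sum>S | S \<subseteq> P \<union> Q \<and> card S = 4. principal_minor (\<lambda>i j. of_bool (E i j)) S)"
    unfolding PQ[symmetric]
    by (intro sum.cong refl principal_minor_cong entry) auto
  also have "\<dots> = (\<Sum>q\<in>Q. \<Sum>p\<in>P. \<Sum>p'\<in>P. \<Sum>q'\<in>Q. of_bool (E p q \<and> E p' q' \<and> E p q' \<and> \<not> E p' q))"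
  proof (rule sum_principal_minors_4_nested_bipartite)
    \<comment> \<open>The two cross sums of class indices have the same total as the two given ones,
      at most \<open>2 * (k + 1)\<close>, so one of them is at most \<open>k + 1\<close>.\<close>
    show "E p q' \<or> E p' q"
      if "p \<in> P" "p' \<in> P" "q \<in> Q" "q' \<in> Q" "E p q" "E p' q'" for p p' q q'
      using that by (auto simp: E_iff)
    show "\<not> E i j" if "i \<in> P" "j \<in> P" for i j using that indepX unfolding P_def E_def by blast
    show "\<not> E i j" if "i \<in> Q" "j \<in> Q" for i j using that indepY unfolding Q_def E_def by blast
    show "P \<inter> Q = {}" using dg(3) unfolding P_def Q_def by blast
  qed (simp_all add: P_def Q_def E_loopfree, rule E_sym)
  also have "\<dots> = (\<Sum>d = 1..k. real (y d) * (\<Sum>a = 1..k. real (x a) *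
      (\<Sum>b = 1..k. real (x b) * (\<Sum>c = 1..k. real (y c) *
        of_bool (a + d \<le> k + 1 \<and> b + c \<le> k + 1 \<and> a + c \<le> k + 1 \<and> \<not> b + d \<le> k + 1)))))"
    by (intro sumX sumY) (simp add: E_iff)
  finally show ?thesis
    unfolding assms(4) sum_characteristic_matrix .
qed

end
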